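(* Let $\mathbb F$ be an algebraically closed field and let $q\in\mathbb F$ be nonzero and not a root of unity. Let $V$ denote an evaluation module for $\boxtimes_q$, with diameter $d$ and evaluation parameter $t$, and let $\Upsilon=(q^{d+1}+q^{-d-1})I$ on $V$. Then on $V$, $$\Upsilon=t(x_{01}x_{23}-1)+qx_{30}+q^{-1}x_{12},\qquad \Upsilon=t^{-1}(x_{12}x_{30}-1)+qx_{01}+q^{-1}x_{23},$$ $$\Upsilon=t(x_{23}x_{01}-1)+qx_{12}+q^{-1}x_{30},\qquad \Upsilon=t^{-1}(x_{30}x_{12}-1)+qx_{23}+q^{-1}x_{01}.$$
   Context: Algebras are associative with 1. $[n]_q=(q^n-q^{-n})/(q-q^{-1})$ and $\mathbb Z_4=\mathbb Z/4\mathbb Z$. The $q$-tetrahedron algebra $\boxtimes_q$ is the $\mathbb F$-algebra with generators (called the standard generators) $\{x_{ij}\mid i,j\in\mathbb Z_4,\ j-i=1\text{ or }j-i=2\}$ and relations: (i) $x_{ij}x_{ji}=1$ if $j-i=2$; (ii) $\frac{qx_{ij}x_{jk}-q^{-1}x_{jk}x_{ij}}{q-q^{-1}}=1$ if $(j-i,k-j)$ is one of $(1,1),(1,2),(2,1)$; (iii) $x_{ij}^3x_{k\ell}-[3]_qx_{ij}^2x_{k\ell}x_{ij}+[3]_qx_{ij}x_{k\ell}x_{ij}^2-x_{k\ell}x_{ij}^3=0$ if $j-i=k-j=\ell-k=1$. Known fact: on a finite-dimensional irreducible $\boxtimes_q$-module $V$ there are $d\in\mathbb N$ (the diameter) and $\varepsilon\in\{1,-1\}$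 (the type) such that each standard generator is diagonalizable with set of distinct eigenvalues $\{\varepsilon q^{d-2n}\mid 0\le n\le d\}$. If $V$ has type 1, the sequence of dimensions of the eigenspaces of $x_{ij}$ for eigenvalues $q^{d},q^{d-2},\dots,q^{-d}$ does not depend on $x_{ij}$; it is called the shape of $V$. The trivial $\boxtimes_q$-module is the one-dimensional module on which every standard generator acts as the identity. An evaluation module for $\boxtimes_q$ is a nontrivial finite-dimensional irreducible $\boxtimes_q$-module of type 1 and shape $(1,1,\dots,1)$ (so $d\ge1$ and $\dim V=d+1$). Matrices in ${\rm Mat}_{d+1}(\mathbb F)$ have rows and columns indexed by $0,\dots,d$; $M$ represents $A$ with respect to a basis $\{v_n\}_{n=0}^d$ when $Av_n=\sum_i M_{in}v_i$. Entries not mentioned below are $0$. A subscript $q^{-1}$ means that $q$ is replaced by $q^{-1}$ in the definition (and similarly $t^{-1}$ as argument). - $Z$: $(i,j)$-entry $\delta_{i+j,d}$. - $K_q$: diagonal, $(i,i)$-entry $q^{d-2i}$. - $E_q$: $(i,i)$-entry $q^{2i-d}$; $(i-1,i)$-entry $q^d-q^{2i-2-d}$. - $G_q(t)$: $(i,i)$-entry $q^{2i-d}$; $(i-1,i)$-entry $(q^d-q^{2i-2-d})(1-tq^{d-2i+1})$. - $L_q(t)$: $(i,i)$-entry $q^{2i-d}$; $(i-1,i)$-entry $(q^d-q^{2i-2-d})(1-tq^{d-2i+1})^{-1}$. - $S_q(t)$: $(i-1,i)$-entry $(q^d-q^{2i-d-2})(1-tq^{2i-d-1})$; $(i,i-1)$-entry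 $(q^{2i-d}-q^{-d})q^{2i-d-1}t$; $(i,i)$-entry $q^d-(q^{2i-d}-q^{-d})q^{2i-d-1}t-(q^d-q^{2i-d})(1-tq^{2i-d+1})$. For an integer $d\ge1$ and a nonzero $t\in\mathbb F$ not among $\{q^{d-2n+1}\}_{n=1}^d$, $\mathbf V_d(t)$ is the evaluation module for $\boxtimes_q$ having a basis with respect to which the standard generators are represented by: $x_{01}: ZS_{q^{-1}}(t^{-1})Z$, $x_{12}: E_q$, $x_{23}: K_q$, $x_{30}: ZG_{q^{-1}}(t)Z$, $x_{02}: L_q(t)$, $x_{13}: (ZE_{q^{-1}}Z)^{-1}$, $x_{20}: (L_q(t))^{-1}$, $x_{31}: ZE_{q^{-1}}Z$. Every evaluation module $V$ of diameter $d$ is isomorphic to $\mathbf V_d(t)$ for a unique such $t$, called the evaluation parameter of $V$. *)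

theory Defs
  imports
    "HOL-Library.Poly_Mapping"
    "HOL-Library.Numeral_Type"
    "HOL-Algebra.QuotRing"
    "HOL-Algebra.Algebraic_Closure_Type"
    "Jordan_Normal_Form.Matrix"
begin

section \<open>The free algebra on the standard generators\<close>

text \<open>The type \<open>4\<close> of \<open>Numeral_Type\<close> is the ring of integers modulo 4.\<close>

typedef gen_index = "{(i, j). (j :: 4) - i = 1 \<or> j - i = 2}"
  by (rule exI[of _ "(0, 1)"]) simp

datatype 'a word = Word (letters: "'a list")

instantiation word :: (type) monoid_add
begin
definition zero_word :: "'a word" where "zero_word = Word []"
definition plus_word :: "'a word \<Rightarrow> 'a word \<Rightarrow> 'a word"
  where "plus_word u w = Word (letters u @ letters w)"
instance by standard (auto simp: zero_word_def plus_word_def)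
end

text \<open>
  Words form the free monoid (written additively, as \<open>Poly_Mapping\<close> requires), so the type below
  with its convolution product is the free associative unital algebra on the generators.
\<close>

type_synonym 'f free_alg = "gen_index word \<Rightarrow>\<^sub>0 'f"

definition const :: "'f::field \<Rightarrow> 'f free_alg"
  where "const c = Poly_Mapping.single 0 c"

text \<open>\<open>gen i j\<close> is meaningful only if \<open>j - i\<close> is 1 or 2.\<close>

definition gen :: "4 \<Rightarrow> 4 \<Rightarrow> 'f::field free_alg"
  where "gen i j = Poly_Mapping.single (Word [Abs_gen_index (i, j)]) 1"

section \<open>The q-tetrahedron algebra\<close>

definition qint :: "'f::field \<Rightarrow> int \<Rightarrow> 'f"
  where "qint q n = (q powi n - q powi (- n)) / (q - inverse q)"

text \<open>Each relation \<open>lhs = rhs\<close> is recorded as the element \<open>lhs - rhs\<close>.\<close>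

definition relators :: "'f::field \<Rightarrow> 'f free_alg set"
  where "relators q =
    {gen i j * gen j i - 1 | i j. j - i = 2} \<union>
    {const (1 / (q - inverse q)) *
       (const q * gen i j * gen j k - const (inverse q) * gen j k * gen i j) - 1
     | i j k. (j - i, k - j) \<in> {(1, 1), (1, 2), (2, 1)}} \<union>
    {gen i j ^ 3 * gen k l - const (qint q 3) * gen i j ^ 2 * gen k l * gen i j
       + const (qint q 3) * gen i j * gen k l * gen i j ^ 2 - gen k l * gen i j ^ 3
     | i j k l. j - i = 1 \<and> k - j = 1 \<and> l - k = 1}"

abbreviation free_ring :: "'f::field free_alg ring"
  where "free_ring \<equiv> ring_of_type_algebra"

definition rel_ideal :: "'f::field \<Rightarrow> 'f free_alg set"
  where "rel_ideal q = genideal free_ring (relators q)"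

definition tet_alg :: "'f::field \<Rightarrow> 'f free_alg set ring"
  where "tet_alg q = free_ring Quot rel_ideal q"

definition tet_gen :: "'f::field \<Rightarrow> 4 \<Rightarrow> 4 \<Rightarrow> 'f free_alg set"
  where "tet_gen q i j = rel_ideal q +>\<^bsub>free_ring\<^esub> gen i j"

definition tet_const :: "'f::field \<Rightarrow> 'f \<Rightarrow> 'f free_alg set"
  where "tet_const q c = rel_ideal q +>\<^bsub>free_ring\<^esub> const c"

section \<open>Modules\<close>

text \<open>
  The underlying vector space of a module is the whole type \<open>'v\<close>, with scalar multiplication
  \<open>scale\<close>; the action is an algebra homomorphism \<open>\<rho>\<close> into the endomorphism algebra.
\<close>

definition End_ring :: "('f::field \<Rightarrow> 'v::ab_group_add \<Rightarrow> 'v) \<Rightarrow> ('v \<Rightarrow> 'v) ring"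
  where "End_ring scale =
    \<lparr>carrier = {f. Vector_Spaces.linear scale scale f},
     monoid.mult = (\<circ>), one = id,
     zero = (\<lambda>v. 0), add = (\<lambda>f g v. f v + g v)\<rparr>"

definition tet_module ::
  "'f::field \<Rightarrow> ('f \<Rightarrow> 'v::ab_group_add \<Rightarrow> 'v) \<Rightarrow> ('f free_alg set \<Rightarrow> 'v \<Rightarrow> 'v) \<Rightarrow> bool"
  where "tet_module q scale \<rho> \<longleftrightarrow>
    vector_space scale \<and> \<rho> \<in> Ring.ring_hom (tet_alg q) (End_ring scale) \<and>
    (\<forall>c. \<rho> (tet_const q c) = scale c)"

definition fin_dim :: "('f::field \<Rightarrow> 'v::ab_group_add \<Rightarrow> 'v) \<Rightarrow> bool"
  where "fin_dim scale \<longleftrightarrow> (\<exists>B. finite B \<and> module.span scale B = UNIV)"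

definition irreducible_module ::
  "'f::field \<Rightarrow> ('f \<Rightarrow> 'v::ab_group_add \<Rightarrow> 'v) \<Rightarrow> ('f free_alg set \<Rightarrow> 'v \<Rightarrow> 'v) \<Rightarrow> bool"
  where "irreducible_module q scale \<rho> \<longleftrightarrow>
    (UNIV :: 'v set) \<noteq> {0} \<and>
    (\<forall>W. module.subspace scale W \<and> (\<forall>a \<in> carrier (tet_alg q). \<rho> a ` W \<subseteq> W)
       \<longrightarrow> W = {0} \<or> W = UNIV)"

definition eigenspace ::
  "('f::field \<Rightarrow> 'v::ab_group_add \<Rightarrow> 'v) \<Rightarrow> ('v \<Rightarrow> 'v) \<Rightarrow> 'f \<Rightarrow> 'v set"
  where "eigenspace scale f c = {v. f v = scale c v}"

definition eigenvalues :: "('f::field \<Rightarrow> 'v::ab_group_add \<Rightarrow> 'v) \<Rightarrow> ('v \<Rightarrow> 'v) \<Rightarrow> 'f set"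
  where "eigenvalues scale f = {c. \<exists>v. v \<noteq> 0 \<and> f v = scale c v}"

definition diagonalizable :: "('f::field \<Rightarrow> 'v::ab_group_add \<Rightarrow> 'v) \<Rightarrow> ('v \<Rightarrow> 'v) \<Rightarrow> bool"
  where "diagonalizable scale f \<longleftrightarrow>
    (\<exists>B. \<not> module.dependent scale B \<and> module.span scale B = UNIV \<and>
         (\<forall>b\<in>B. \<exists>c. f b = scale c b))"

definition diameter_type ::
  "'f::field \<Rightarrow> ('f \<Rightarrow> 'v::ab_group_add \<Rightarrow> 'v) \<Rightarrow> ('f free_alg set \<Rightarrow> 'v \<Rightarrow> 'v) \<Rightarrow> nat \<Rightarrow> 'f \<Rightarrow> bool"
  where "diameter_type q scale \<rho> d \<epsilon> \<longleftrightarrow>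
    \<epsilon> \<in> {1, -1} \<and>
    (\<forall>i j. j - i = 1 \<or> j - i = 2 \<longrightarrow>
       diagonalizable scale (\<rho> (tet_gen q i j)) \<and>
       eigenvalues scale (\<rho> (tet_gen q i j)) = {\<epsilon> * q powi (int d - 2 * int n) | n. n \<le> d})"

definition has_shape ::
  "'f::field \<Rightarrow> ('f \<Rightarrow> 'v::ab_group_add \<Rightarrow> 'v) \<Rightarrow> ('f free_alg set \<Rightarrow> 'v \<Rightarrow> 'v) \<Rightarrow> nat \<Rightarrow> nat list \<Rightarrow> bool"
  where "has_shape q scale \<rho> d s \<longleftrightarrow>
    length s = d + 1 \<and>
    (\<forall>i j. j - i = 1 \<or> j - i = 2 \<longrightarrow>
      (\<forall>n\<le>d. vector_space.dim scale
         (eigenspace scale (\<rho> (tet_gen q i j)) (q powi (int d - 2 * int n))) = s ! n))"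

definition trivial_module ::
  "'f::field \<Rightarrow> ('f \<Rightarrow> 'v::ab_group_add \<Rightarrow> 'v) \<Rightarrow> ('f free_alg set \<Rightarrow> 'v \<Rightarrow> 'v) \<Rightarrow> bool"
  where "trivial_module q scale \<rho> \<longleftrightarrow>
    vector_space.dim scale (UNIV :: 'v set) = 1 \<and>
    (\<forall>i j. j - i = 1 \<or> j - i = 2 \<longrightarrow> \<rho> (tet_gen q i j) = id)"

definition evaluation_module ::
  "'f::field \<Rightarrow> ('f \<Rightarrow> 'v::ab_group_add \<Rightarrow> 'v) \<Rightarrow> ('f free_alg set \<Rightarrow> 'v \<Rightarrow> 'v) \<Rightarrow> nat \<Rightarrow> bool"
  where "evaluation_module q scale \<rho> d \<longleftrightarrow>
    tet_module q scale \<rho> \<and> fin_dim scale \<and> irreducible_module q scale \<rho> \<and>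
    \<not> trivial_module q scale \<rho> \<and>
    diameter_type q scale \<rho> d 1 \<and> has_shape q scale \<rho> d (replicate (d + 1) 1)"

section \<open>The matrices\<close>

text \<open>
  Entry \<open>(i - 1, i)\<close> is the case \<open>c = r + 1\<close> with \<open>i = c\<close>; entry \<open>(i, i - 1)\<close> is the case
  \<open>r = c + 1\<close> with \<open>i = r\<close>. The subscript \<open>q\<close> is an explicit argument.
\<close>

definition matZ :: "nat \<Rightarrow> 'f::field mat"
  where "matZ d = mat (d + 1) (d + 1) (\<lambda>(i, j). if i + j = d then 1 else 0)"

definition matK :: "nat \<Rightarrow> 'f::field \<Rightarrow> 'f mat"
  where "matK d q = mat (d + 1) (d + 1)
    (\<lambda>(r, c). if r = c then q powi (int d - 2 * int r) else 0)"

definition matE :: "nat \<Rightarrow> 'f::field \<Rightarrow> 'f mat"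
  where "matE d q = mat (d + 1) (d + 1)
    (\<lambda>(r, c). if r = c then q powi (2 * int r - int d)
      else if c = r + 1 then q powi int d - q powi (2 * int c - 2 - int d)
      else 0)"

definition matG :: "nat \<Rightarrow> 'f::field \<Rightarrow> 'f \<Rightarrow> 'f mat"
  where "matG d q t = mat (d + 1) (d + 1)
    (\<lambda>(r, c). if r = c then q powi (2 * int r - int d)
      else if c = r + 1 then
        (q powi int d - q powi (2 * int c - 2 - int d)) * (1 - t * q powi (int d - 2 * int c + 1))
      else 0)"

definition matL :: "nat \<Rightarrow> 'f::field \<Rightarrow> 'f \<Rightarrow> 'f mat"
  where "matL d q t = mat (d + 1) (d + 1)
    (\<lambda>(r, c). if r = c then q powi (2 * int r - int d)
      else if c = r + 1 then
        (q powi int d - q powi (2 * int c - 2 - int d)) *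
        inverse (1 - t * q powi (int d - 2 * int c + 1))
      else 0)"

definition matS :: "nat \<Rightarrow> 'f::field \<Rightarrow> 'f \<Rightarrow> 'f mat"
  where "matS d q t = mat (d + 1) (d + 1)
    (\<lambda>(r, c). if c = r + 1 then
        (q powi int d - q powi (2 * int c - int d - 2)) * (1 - t * q powi (2 * int c - int d - 1))
      else if r = c + 1 then
        (q powi (2 * int r - int d) - q powi (- int d)) * q powi (2 * int r - int d - 1) * t
      else if r = c then
        q powi int d
        - (q powi (2 * int r - int d) - q powi (- int d)) * q powi (2 * int r - int d - 1) * t
        - (q powi int d - q powi (2 * int r - int d)) * (1 - t * q powi (2 * int r - int d + 1))
      else 0)"

abbreviation mat_inv :: "nat \<Rightarrow> 'f::field mat \<Rightarrow> 'f mat"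
  where "mat_inv d M \<equiv> inv\<^bsub>ring_mat TYPE('f) (d + 1) ()\<^esub> M"

section \<open>The evaluation parameter\<close>

definition is_basis :: "('f::field \<Rightarrow> 'v::ab_group_add \<Rightarrow> 'v) \<Rightarrow> nat \<Rightarrow> (nat \<Rightarrow> 'v) \<Rightarrow> bool"
  where "is_basis scale d v \<longleftrightarrow>
    inj_on v {..d} \<and> \<not> module.dependent scale (v ` {..d}) \<and> module.span scale (v ` {..d}) = UNIV"

definition represents ::
  "('f::field \<Rightarrow> 'v::ab_group_add \<Rightarrow> 'v) \<Rightarrow> nat \<Rightarrow> (nat \<Rightarrow> 'v) \<Rightarrow> 'f mat \<Rightarrow> ('v \<Rightarrow> 'v) \<Rightarrow> bool"
  where "represents scale d v M A \<longleftrightarrow>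
    (\<forall>n\<le>d. A (v n) = (\<Sum>i\<le>d. scale (M $$ (i, n)) (v i)))"

text \<open>
  The module \<open>V\<^sub>d(t)\<close> is specified up to isomorphism by the existence of a basis with
  prescribed representing matrices, so being isomorphic to it means having such a basis.
\<close>

definition evaluation_parameter ::
  "'f::field \<Rightarrow> ('f \<Rightarrow> 'v::ab_group_add \<Rightarrow> 'v) \<Rightarrow> ('f free_alg set \<Rightarrow> 'v \<Rightarrow> 'v) \<Rightarrow> nat \<Rightarrow> 'f \<Rightarrow> bool"
  where "evaluation_parameter q scale \<rho> d t \<longleftrightarrow>
    d \<ge> 1 \<and> t \<noteq> 0 \<and> t \<notin> {q powi (int d - 2 * int n + 1) | n. 1 \<le> n \<and> n \<le> d} \<and>
    (\<exists>v. is_basis scale d v \<and>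
      represents scale d v (matZ d * matS d (inverse q) (inverse t) * matZ d) (\<rho> (tet_gen q 0 1)) \<and>
      represents scale d v (matE d q) (\<rho> (tet_gen q 1 2)) \<and>
      represents scale d v (matK d q) (\<rho> (tet_gen q 2 3)) \<and>
      represents scale d v (matZ d * matG d (inverse q) t * matZ d) (\<rho> (tet_gen q 3 0)) \<and>
      represents scale d v (matL d q t) (\<rho> (tet_gen q 0 2)) \<and>
      represents scale d v (mat_inv d (matZ d * matE d (inverse q) * matZ d)) (\<rho> (tet_gen q 1 3)) \<and>
      represents scale d v (mat_inv d (matL d q t)) (\<rho> (tet_gen q 2 0)) \<and>
      represents scale d v (matZ d * matE d (inverse q) * matZ d) (\<rho> (tet_gen q 3 1)))"

definition Upsilon :: "'f::field \<Rightarrow> ('f \<Rightarrow> 'v::ab_group_add \<Rightarrow> 'v) \<Rightarrow> nat \<Rightarrow> 'v \<Rightarrow> 'v"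
  where "Upsilon q scale d v = scale (q powi (int d + 1) + q powi (- int d - 1)) v"

end

theory Submission
  imports Defs
begin

text \<open>
  Each of the four identities is an equality of linear maps, so by \<open>linear_relation_from_span\<close> it is
  enough to check it on the basis \<open>v\<^sub>0, \<dots>, v\<^sub>d\<close> that defines the evaluation parameter. In this basis \<open>x\<^sub>1\<^sub>2\<close> is
  upper bidiagonal, \<open>x\<^sub>2\<^sub>3\<close> diagonal, \<open>x\<^sub>3\<^sub>0\<close> lower bidiagonal and \<open>x\<^sub>0\<^sub>1\<close> tridiagonal, so both
  sides map \<open>v\<^sub>n\<close> to a combination of \<open>v\<^sub>n\<^sub>-\<^sub>1\<close>, \<open>v\<^sub>n\<close> and \<open>v\<^sub>n\<^sub>+\<^sub>1\<close>. Put \<open>u = q\<^sup>2\<^sup>n\<^sup>-\<^sup>d\<close> and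
  \<open>Q = q\<^sup>d\<close>. Every coefficient that occurs is a rational function of \<open>q\<close>, \<open>t\<close>, \<open>u\<close>, \<open>Q\<close>,
  and comparing coefficients leaves three identities in the field for each of the four equations;
  the coefficients of \<open>v\<^sub>n\<^sub>-\<^sub>1\<close> and \<open>v\<^sub>n\<^sub>+\<^sub>1\<close> cancel, and the coefficient of \<open>v\<^sub>n\<close> is
  \<open>qQ + (qQ)\<^sup>-\<^sup>1\<close> (\<open>Upsilon_identities_on_basis\<close>). The coefficients themselves are read off
  the matrices in \<open>tridiagonal_entries\<close>.

  To treat the two ends of the basis like its interior, the basis is extended by zero to a family
  indexed by all integers (\<open>zero_extend\<close>). The formulas for \<open>x\<^sub>1\<^sub>2\<close> and \<open>x\<^sub>3\<^sub>0\<close>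
  survive one step beyond the ends, because the coefficient \<open>q\<^sup>d - q\<^sup>2\<^sup>n\<^sup>-\<^sup>2\<^sup>-\<^sup>d\<close> by which \<open>x\<^sub>1\<^sub>2\<close>
  would lead back from \<open>n = d + 1\<close> to \<open>d\<close>, and the factor \<open>q\<^sup>-\<^sup>d - q\<^sup>2\<^sup>n\<^sup>+\<^sup>2\<^sup>-\<^sup>d\<close> by which
  \<open>x\<^sub>3\<^sub>0\<close> would lead back from \<open>n = -1\<close> to \<open>0\<close>, both vanish. That is all that the products
  \<open>x\<^sub>1\<^sub>2 x\<^sub>3\<^sub>0\<close> and \<open>x\<^sub>3\<^sub>0 x\<^sub>1\<^sub>2\<close> require.
\<close>

section \<open>Reduction to a spanning set\<close>

lemma linear_tet_gen:
  fixes q :: "'f::field" and scale :: "'f \<Rightarrow> 'v::ab_group_add \<Rightarrow> 'v"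
  assumes "tet_module q scale \<rho>"
  shows "Vector_Spaces.linear scale scale (\<rho> (tet_gen q i j))"
proof -
  have "tet_gen q i j \<in> carrier (tet_alg q)"
    unfolding tet_gen_def tet_alg_def FactRing_def A_RCOSETS_def'
    by (auto simp: ring_of_type_algebra_def)
  then show ?thesis
    using assms ring_hom_closed[of \<rho> "tet_alg q" "End_ring scale"]
    by (auto simp: tet_module_def End_ring_def)
qed

lemma linear_relation_from_span:
  fixes scale :: "'f::field \<Rightarrow> 'v::ab_group_add \<Rightarrow> 'v"
  assumes lin: "Vector_Spaces.linear scale scale A" "Vector_Spaces.linear scale scale B"
      "Vector_Spaces.linear scale scale C" "Vector_Spaces.linear scale scale D"
    and span: "module.span scale S = UNIV"
    and on_S: "\<And>v. v \<in> S \<Longrightarrow>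
      scale k v = scale s (A (B v) - v) + scale a (C v) + scale b (D v)"
  shows "scale k v = scale s (A (B v) - v) + scale a (C v) + scale b (D v)"
proof -
  interpret A: Vector_Spaces.linear scale scale A by fact
  interpret B: Vector_Spaces.linear scale scale B by fact
  interpret C: Vector_Spaces.linear scale scale C by fact
  interpret D: Vector_Spaces.linear scale scale D by fact
  have "v \<in> module.span scale S"
    using span by simp
  then show ?thesis
  proof (induction rule: A.vs1.span_induct_alt)
    case base
    show ?case by (simp add: A.zero B.zero C.zero D.zero)
  next
    case (step c x y)
    have "scale k (scale c x) = scale c (scale k x)"
      by (simp add: mult.commute)
    also have "\<dots> = scale s (A (B (scale c x)) - scale c x)
        + scale a (C (scale c x)) + scale b (D (scale c x))"
      unfolding on_S[OF step.hyps]
      by (simp add: A.scale B.scale C.scale D.scale algebra_simps)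
    finally show ?case
      using step.IH by (simp add: A.add B.add C.add D.add algebra_simps)
  qed
qed

section \<open>Tridiagonal actions on a basis extended by zero\<close>

definition zero_extend :: "nat \<Rightarrow> (nat \<Rightarrow> 'v::zero) \<Rightarrow> int \<Rightarrow> 'v"
  where "zero_extend d v k = (if 0 \<le> k \<and> k \<le> int d then v (nat k) else 0)"

lemma sum_delta_zero_extend:
  fixes scale :: "'f::field \<Rightarrow> 'v::ab_group_add \<Rightarrow> 'v"
  assumes "vector_space scale"
  shows "(\<Sum>i\<le>d. if int i = k then scale c (v i) else 0) = scale c (zero_extend d v k)"
proof -
  interpret vector_space scale by fact
  show ?thesis
  proof (cases "0 \<le> k \<and> k \<le> int d")
    case True
    then have "(\<Sum>i\<le>d. if int i = k then scale c (v i) else 0)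
        = (\<Sum>i\<le>d. if i = nat k then scale c (v i) else 0)"
      by (intro sum.cong) auto
    with True show ?thesis
      by (simp add: zero_extend_def nat_le_iff)
  next
    case False
    then show ?thesis
      by (auto simp: zero_extend_def intro!: sum.neutral)
  qed
qed

lemma tridiagonal_action:
  fixes scale :: "'f::field \<Rightarrow> 'v::ab_group_add \<Rightarrow> 'v"
  assumes vs: "vector_space scale"
    and rep: "represents scale d v M A"
    and n: "0 \<le> n" "n \<le> int d"
    and entry: "\<And>i. i \<le> d \<Longrightarrow> M $$ (i, nat n) =
      (if int i = n - 1 then cU else if int i = n then cD else if int i = n + 1 then cL else 0)"
  shows "A (zero_extend d v n) = scale cU (zero_extend d v (n - 1))
    + scale cD (zero_extend d v n) + scale cL (zero_extend d v (n + 1))"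
proof -
  interpret vector_space scale by fact
  have "A (zero_extend d v n) = (\<Sum>i\<le>d. scale (M $$ (i, nat n)) (v i))"
    using rep n by (simp add: represents_def zero_extend_def nat_le_iff)
  also have "\<dots> = (\<Sum>i\<le>d. (if int i = n - 1 then scale cU (v i) else 0)
      + (if int i = n then scale cD (v i) else 0)
      + (if int i = n + 1 then scale cL (v i) else 0))"
    by (intro sum.cong) (auto simp: entry)
  finally show ?thesis
    by (simp add: sum.distrib sum_delta_zero_extend[OF vs])
qed

text \<open>
  \<open>Z\<close> is the permutation matrix of the involution \<open>i \<mapsto> d - i\<close>, so conjugation by it reverses
  the order of the rows and of the columns.
\<close>

lemma matZ_conj_entry:
  fixes M :: "'f::field mat"
  assumes M: "M \<in> carrier_mat (d + 1) (d + 1)" and ij: "i \<le> d" "j \<le> d"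
  shows "(matZ d * M * matZ d) $$ (i, j) = M $$ (d - i, d - j)"
proof -
  have left: "(matZ d * M) $$ (i, k) = M $$ (d - i, k)" if "k \<le> d" for k
  proof -
    have "(matZ d * M) $$ (i, k) = (\<Sum>l<d+1. (if i + l = d then 1 else 0) * M $$ (l, k))"
      using M ij that by (simp add: matZ_def scalar_prod_def atLeast0LessThan)
    also have "\<dots> = (\<Sum>l<d+1. if l = d - i then M $$ (l, k) else 0)"
      using ij by (intro sum.cong) auto
    finally show ?thesis using ij by simp
  qed
  have "(matZ d * M * matZ d) $$ (i, j)
      = (\<Sum>l<d+1. (matZ d * M) $$ (i, l) * (if l + j = d then 1 else 0))"
    using M ij by (simp add: matZ_def scalar_prod_def atLeast0LessThan del: index_mult_mat(1))
      (simp add: scalar_prod_def atLeast0LessThan)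
  also have "\<dots> = (\<Sum>l<d+1. if l = d - j then (matZ d * M) $$ (i, l) else 0)"
    using ij by (intro sum.cong) auto
  finally show ?thesis using ij left by simp
qed

section \<open>Comparison of coefficients\<close>

lemma tridiagonal_combination:
  fixes scale :: "'f::field \<Rightarrow> 'v::ab_group_add \<Rightarrow> 'v"
  assumes "vector_space scale"
    and "y = scale a1 w1 + scale a2 w2 + scale a3 w3"
    and "y' = scale b1 w1 + scale b2 w2 + scale b3 w3"
    and "y'' = scale c1 w1 + scale c2 w2 + scale c3 w3"
    and "s * a1 + r * b1 + r' * c1 = 0"
    and "s * (a2 - 1) + r * b2 + r' * c2 = k"
    and "s * a3 + r * b3 + r' * c3 = 0"
  shows "scale k w2 = scale s (y - w2) + scale r y' + scale r' y''"
proof -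
  interpret vector_space scale by fact
  have "scale s (y - w2) + scale r y' + scale r' y''
      = scale (s * a1 + r * b1 + r' * c1) w1 + scale (s * (a2 - 1) + r * b2 + r' * c2) w2
        + scale (s * a3 + r * b3 + r' * c3) w3"
    unfolding assms(2-4) by (simp add: algebra_simps)
  then show ?thesis using assms(5-7) by simp
qed

text \<open>
  The family \<open>w\<close> stands for the basis extended by zero, \<open>u n\<close> for \<open>q\<^sup>2\<^sup>n\<^sup>-\<^sup>d\<close> and \<open>Q\<close> for \<open>q\<^sup>d\<close>,
  while \<open>A\<close>, \<open>B\<close>, \<open>C\<close>, \<open>D\<close> stand for \<open>x\<^sub>0\<^sub>1\<close>, \<open>x\<^sub>1\<^sub>2\<close>, \<open>x\<^sub>2\<^sub>3\<close>, \<open>x\<^sub>3\<^sub>0\<close>. The ranges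
  of \<open>m\<close> follow the products: \<open>D\<close> moves \<open>w n\<close> up to \<open>w (n + 1)\<close>, where \<open>B\<close> acts next, and \<open>B\<close>
  moves it down to \<open>w (n - 1)\<close>, where \<open>D\<close> acts next. For \<open>0 \<le> n \<le> d\<close> these indices reach just one
  step beyond the ends of the basis.
  Since \<open>u\<close> is a geometric progression, all coefficients become rational functions of \<open>u n\<close>.
\<close>

lemma Upsilon_identities_on_basis:
  fixes scale :: "'f::field \<Rightarrow> 'v::ab_group_add \<Rightarrow> 'v" and w :: "int \<Rightarrow> 'v" and u :: "int \<Rightarrow> 'f"
  assumes lin: "Vector_Spaces.linear scale scale A" "Vector_Spaces.linear scale scale B"
      "Vector_Spaces.linear scale scale C" "Vector_Spaces.linear scale scale D"
    and nz: "q \<noteq> 0" "t \<noteq> 0" "Q \<noteq> 0" "u n \<noteq> 0"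
    and u: "u (n + 1) = q\<^sup>2 * u n" "u (n - 1) = u n / q\<^sup>2"
    and A: "A (w n) = scale ((u n / q\<^sup>2 - Q) * (u n / (q * t))) (w (n - 1))
      + scale (1 / Q - (u n - Q) * (q * u n / t) - (1 / Q - u n) * (1 - u n / (q * t))) (w n)
      + scale ((1 / Q - q\<^sup>2 * u n) * (1 - q * u n / t)) (w (n + 1))"
    and B: "\<And>m. m \<in> {n, n + 1} \<Longrightarrow>
      B (w m) = scale (Q - u m / q\<^sup>2) (w (m - 1)) + scale (u m) (w m)"
    and C: "\<And>m. m \<in> {n - 1, n, n + 1} \<Longrightarrow> C (w m) = scale (1 / u m) (w m)"
    and D: "\<And>m. m \<in> {n - 1, n} \<Longrightarrow>
      D (w m) = scale (u m) (w m) + scale ((1 / Q - q\<^sup>2 * u m) * (1 - t / (q * u m))) (w (m + 1))"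
  defines "k \<equiv> q * Q + 1 / (q * Q)"
  shows
    "scale k (w n) = scale t (A (C (w n)) - w n) + scale q (D (w n)) + scale (inverse q) (B (w n))"
    "scale k (w n) =
      scale (inverse t) (B (D (w n)) - w n) + scale q (A (w n)) + scale (inverse q) (C (w n))"
    "scale k (w n) = scale t (C (A (w n)) - w n) + scale q (B (w n)) + scale (inverse q) (D (w n))"
    "scale k (w n) =
      scale (inverse t) (D (B (w n)) - w n) + scale q (C (w n)) + scale (inverse q) (A (w n))"
proof -
  interpret A: Vector_Spaces.linear scale scale A by fact
  interpret B: Vector_Spaces.linear scale scale B by fact
  interpret C: Vector_Spaces.linear scale scale C by fact
  interpret D: Vector_Spaces.linear scale scale D by fact
  note vs = A.vs1.vector_space_axioms
  \<comment> \<open>The coefficients stay opaque until the products are expanded, so that simplification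
    collects the three basis vectors without multiplying out the field elements.\<close>
  define cU where "cU = (u n / q\<^sup>2 - Q) * (u n / (q * t))"
  define cD where
    "cD = 1 / Q - (u n - Q) * (q * u n / t) - (1 / Q - u n) * (1 - u n / (q * t))"
  define cL where "cL = (1 / Q - q\<^sup>2 * u n) * (1 - q * u n / t)"
  define e where "e m = Q - u m / q\<^sup>2" for m
  define g where "g m = (1 / Q - q\<^sup>2 * u m) * (1 - t / (q * u m))" for m
  note folded = cU_def[symmetric] cD_def[symmetric] cL_def[symmetric]
    e_def[symmetric] g_def[symmetric]
  note unfolded = cU_def cD_def cL_def e_def g_def k_def u
  have A0: "A (w n) = scale cU (w (n - 1)) + scale cD (w n) + scale cL (w (n + 1))"
    using A unfolding folded .
  have B0: "B (w n) = scale (e n) (w (n - 1)) + scale (u n) (w n) + scale 0 (w (n + 1))"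
    and B1: "B (w (n + 1)) = scale (e (n + 1)) (w n) + scale (u (n + 1)) (w (n + 1))"
    using B[of n] B[of "n + 1"] by (simp_all add: folded)
  have C0: "C (w n) = scale 0 (w (n - 1)) + scale (1 / u n) (w n) + scale 0 (w (n + 1))"
    using C[of n] by simp
  have D0: "D (w n) = scale 0 (w (n - 1)) + scale (u n) (w n) + scale (g n) (w (n + 1))"
    and D1: "D (w (n - 1)) = scale (u (n - 1)) (w (n - 1)) + scale (g (n - 1)) (w n)"
    using D[of n] D[of "n - 1"] by (simp_all add: folded)
  have AC: "A (C (w n)) = scale (cU / u n) (w (n - 1)) + scale (cD / u n) (w n)
      + scale (cL / u n) (w (n + 1))"
    using C[of n] A0 by (simp add: A.scale algebra_simps)
  have CA: "C (A (w n)) = scale (cU / u (n - 1)) (w (n - 1)) + scale (cD / u n) (w n)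
      + scale (cL / u (n + 1)) (w (n + 1))"
    unfolding A0 by (simp add: C.add C.scale C)
  have BD: "B (D (w n)) = scale (u n * e n) (w (n - 1))
      + scale (u n * u n + g n * e (n + 1)) (w n) + scale (g n * u (n + 1)) (w (n + 1))"
    unfolding D0 by (simp add: B.add B.scale B0 B1) (simp add: algebra_simps)
  have DB: "D (B (w n)) = scale (e n * u (n - 1)) (w (n - 1))
      + scale (u n * u n + e n * g (n - 1)) (w n) + scale (u n * g n) (w (n + 1))"
    unfolding B0 by (simp add: D.add D.scale D0 D1) (simp add: algebra_simps)
  show "scale k (w n)
      = scale t (A (C (w n)) - w n) + scale q (D (w n)) + scale (inverse q) (B (w n))"
    by (rule tridiagonal_combination[OF vs AC D0 B0]; unfold unfolded;
        use nz in \<open>simp add: divide_simps; simp add: algebra_simps power2_eq_square power4_eq_xxxx\<close>)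
  show "scale k (w n)
      = scale (inverse t) (B (D (w n)) - w n) + scale q (A (w n)) + scale (inverse q) (C (w n))"
    by (rule tridiagonal_combination[OF vs BD A0 C0]; unfold unfolded;
        use nz in \<open>simp add: divide_simps; simp add: algebra_simps power2_eq_square power4_eq_xxxx\<close>)
  show "scale k (w n)
      = scale t (C (A (w n)) - w n) + scale q (B (w n)) + scale (inverse q) (D (w n))"
    by (rule tridiagonal_combination[OF vs CA B0 D0]; unfold unfolded;
        use nz in \<open>simp add: divide_simps; simp add: algebra_simps power2_eq_square power4_eq_xxxx\<close>)
  show "scale k (w n)
      = scale (inverse t) (D (B (w n)) - w n) + scale q (C (w n)) + scale (inverse q) (A (w n))"
    by (rule tridiagonal_combination[OF vs DB C0 A0]; unfold unfolded;
        use nz in \<open>simp add: divide_simps; simp add: algebra_simps power2_eq_square power4_eq_xxxx\<close>)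
qed

section \<open>The action of the standard generators\<close>

text \<open>
  The column index is an integer so that the shifts \<open>n - 1\<close> and \<open>n + 1\<close> are not truncated. In the
  two conjugated matrices, reversing the indices swaps the two off-diagonals and inverts
  \<open>q\<^sup>2\<^sup>i\<^sup>-\<^sup>d\<close>; the inversion of \<open>q\<close> undoes the latter, so the conjugate of \<open>G\<close> again has the
  diagonal entry \<open>u\<close>.
\<close>

lemma tridiagonal_entries:
  fixes q t :: "'f::field" and n :: int
  assumes q: "q \<noteq> 0" and n: "0 \<le> n" "n \<le> int d" and i: "i \<le> d"
  defines "Q \<equiv> q powi int d" and "u \<equiv> q powi (2 * n - int d)"
  shows
    "matE d q $$ (i, nat n) = (if int i = n - 1 then Q - u / q\<^sup>2 else if int i = n then u
      else if int i = n + 1 then 0 else 0)"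
    "matK d q $$ (i, nat n) = (if int i = n - 1 then 0 else if int i = n then 1 / u
      else if int i = n + 1 then 0 else 0)"
    "(matZ d * matG d (inverse q) t * matZ d) $$ (i, nat n) =
      (if int i = n - 1 then 0 else if int i = n then u
       else if int i = n + 1 then (1 / Q - q\<^sup>2 * u) * (1 - t / (q * u)) else 0)"
    "(matZ d * matS d (inverse q) (inverse t) * matZ d) $$ (i, nat n) =
      (if int i = n - 1 then (u / q\<^sup>2 - Q) * (u / (q * t))
       else if int i = n
         then 1 / Q - (u - Q) * (q * u / t) - (1 / Q - u) * (1 - u / (q * t))
       else if int i = n + 1 then (1 / Q - q\<^sup>2 * u) * (1 - q * u / t) else 0)"
proof -
  have carrier: "matG d (inverse q) t \<in> carrier_mat (d + 1) (d + 1)"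
      "matS d (inverse q) (inverse t) \<in> carrier_mat (d + 1) (d + 1)"
    by (auto simp: matG_def matS_def)
  have nat_n: "nat n \<le> d" using n by simp
  obtain m where m: "n = int m" "m \<le> d"
    using n by (metis nonneg_int_cases of_nat_le_iff)
  note pow = power_int_add[OF disjI1[OF q]] power_int_diff[OF disjI1[OF q]] power_int_minus
    power_int_mult_distrib power_int_inverse power2_eq_square
  show "matE d q $$ (i, nat n) = (if int i = n - 1 then Q - u / q\<^sup>2 else if int i = n then u
      else if int i = n + 1 then 0 else 0)"
    using q m i by (auto simp: matE_def Q_def u_def pow field_simps)
  show "matK d q $$ (i, nat n) = (if int i = n - 1 then 0 else if int i = n then 1 / u
      else if int i = n + 1 then 0 else 0)"
    using q m i by (auto simp: matK_def Q_def u_def pow field_simps)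
  show "(matZ d * matG d (inverse q) t * matZ d) $$ (i, nat n) =
      (if int i = n - 1 then 0 else if int i = n then u
       else if int i = n + 1 then (1 / Q - q\<^sup>2 * u) * (1 - t / (q * u)) else 0)"
    unfolding matZ_conj_entry[OF carrier(1) i nat_n]
    using q m i by (auto simp: matG_def Q_def u_def pow of_nat_diff field_simps)
  show "(matZ d * matS d (inverse q) (inverse t) * matZ d) $$ (i, nat n) =
      (if int i = n - 1 then (u / q\<^sup>2 - Q) * (u / (q * t))
       else if int i = n
         then 1 / Q - (u - Q) * (q * u / t) - (1 / Q - u) * (1 - u / (q * t))
       else if int i = n + 1 then (1 / Q - q\<^sup>2 * u) * (1 - q * u / t) else 0)"
    unfolding matZ_conj_entry[OF carrier(2) i nat_n]
    using q m i by (auto simp: matS_def Q_def u_def pow of_nat_diff field_simps)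
qed

theorem lemma9p11:
  fixes q t :: "'f::alg_closed_field"
    and scale :: "'f \<Rightarrow> 'v::ab_group_add \<Rightarrow> 'v"
    and \<rho> :: "'f free_alg set \<Rightarrow> 'v \<Rightarrow> 'v"
    and x :: "4 \<Rightarrow> 4 \<Rightarrow> 'v \<Rightarrow> 'v"
    and d :: nat
  assumes "q \<noteq> 0"
    and "\<forall>n::nat. n \<ge> 1 \<longrightarrow> q ^ n \<noteq> 1"
    and "evaluation_module q scale \<rho> d"
    and "evaluation_parameter q scale \<rho> d t"
    and "\<And>i j. x i j = \<rho> (tet_gen q i j)"
  shows "(\<forall>v. Upsilon q scale d v =
            scale t (x 0 1 (x 2 3 v) - v) + scale q (x 3 0 v) + scale (inverse q) (x 1 2 v)) \<and>
         (\<forall>v. Upsilon q scale d v =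
            scale (inverse t) (x 1 2 (x 3 0 v) - v) + scale q (x 0 1 v) + scale (inverse q) (x 2 3 v)) \<and>
         (\<forall>v. Upsilon q scale d v =
            scale t (x 2 3 (x 0 1 v) - v) + scale q (x 1 2 v) + scale (inverse q) (x 3 0 v)) \<and>
         (\<forall>v. Upsilon q scale d v =
            scale (inverse t) (x 3 0 (x 1 2 v) - v) + scale q (x 2 3 v) + scale (inverse q) (x 0 1 v))"
proof -
  have "tet_module q scale \<rho>"
    using assms(3) by (simp add: evaluation_module_def)
  then have lin: "Vector_Spaces.linear scale scale (x i j)" for i j
    using assms(5) linear_tet_gen by simp
  interpret vector_space scale
    using \<open>tet_module q scale \<rho>\<close> by (simp add: tet_module_def)
  note q = assms(1)
  obtain b where t: "t \<noteq> 0" and b: "is_basis scale d b"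
    and rep: "represents scale d b (matZ d * matS d (inverse q) (inverse t) * matZ d) (x 0 1)"
      "represents scale d b (matE d q) (x 1 2)"
      "represents scale d b (matK d q) (x 2 3)"
      "represents scale d b (matZ d * matG d (inverse q) t * matZ d) (x 3 0)"
    using assms(4) unfolding evaluation_parameter_def assms(5) by blast
  define w where "w = zero_extend d b"
  define Q where "Q = q powi int d"
  define u where "u n = q powi (2 * n - int d)" for n
  have nz: "Q \<noteq> 0" "u n \<noteq> 0" for n
    using q by (simp_all add: Q_def u_def)
  have u_shift: "u (n + 1) = q\<^sup>2 * u n" "u (n - 1) = u n / q\<^sup>2" for n
    using q by (simp_all add: u_def power_int_add power_int_diff power2_eq_square field_simps)
  have x_zero: "x i j 0 = 0" for i j
    using lin[of i j] by (metis Vector_Spaces.linear.axioms(3) module_hom.zero)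
  have w_out: "w n = 0" if "n < 0 \<or> n > int d" for n
    using that by (auto simp: w_def zero_extend_def)
  note act = tridiagonal_action[OF vector_space_axioms _ _ _ tridiagonal_entries(1)[OF q]]
    tridiagonal_action[OF vector_space_axioms _ _ _ tridiagonal_entries(2)[OF q]]
    tridiagonal_action[OF vector_space_axioms _ _ _ tridiagonal_entries(3)[OF q]]
    tridiagonal_action[OF vector_space_axioms _ _ _ tridiagonal_entries(4)[OF q]]
  have x01: "x 0 1 (w n) = scale ((u n / q\<^sup>2 - Q) * (u n / (q * t))) (w (n - 1))
      + scale (1 / Q - (u n - Q) * (q * u n / t) - (1 / Q - u n) * (1 - u n / (q * t))) (w n)
      + scale ((1 / Q - q\<^sup>2 * u n) * (1 - q * u n / t)) (w (n + 1))"
    if "0 \<le> n" "n \<le> int d" for n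
    using act(4)[OF rep(1) that that] unfolding w_def Q_def u_def .
  have x12: "x 1 2 (w n) = scale (Q - u n / q\<^sup>2) (w (n - 1)) + scale (u n) (w n)"
    if "0 \<le> n" "n \<le> int d + 1" for n
  proof (cases "n = int d + 1")
    case True
    \<comment> \<open>Here \<open>u n = q\<^sup>2 Q\<close>.\<close>
    have "u n / q\<^sup>2 = Q"
      using q True by (simp add: u_def Q_def power_int_add power2_eq_square)
    then show ?thesis using True by (simp add: w_out x_zero)
  next
    case False
    then show ?thesis
      using act(1)[OF rep(2), of n] that unfolding w_def Q_def u_def by simp
  qed
  have x23: "x 2 3 (w n) = scale (1 / u n) (w n)" for n
  proof (cases "0 \<le> n \<and> n \<le> int d")
    case True
    then show ?thesis
      using act(2)[OF rep(3), of n] unfolding w_def u_def by simp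
  next
    case False
    then show ?thesis by (auto simp: w_out x_zero)
  qed
  have x30: "x 3 0 (w n)
      = scale (u n) (w n) + scale ((1 / Q - q\<^sup>2 * u n) * (1 - t / (q * u n))) (w (n + 1))"
    if "- 1 \<le> n" "n \<le> int d" for n
  proof (cases "n = - 1")
    case True
    \<comment> \<open>Here \<open>u n = q\<^sup>-\<^sup>2 Q\<^sup>-\<^sup>1\<close>.\<close>
    have "1 / Q - q\<^sup>2 * u n = 0"
      using q True
      by (simp add: u_def Q_def power_int_diff power_int_minus power2_eq_square field_simps)
    then show ?thesis using True by (simp add: w_out x_zero)
  next
    case False
    then show ?thesis
      using act(3)[OF rep(4), of n] that unfolding w_def Q_def u_def by simp
  qed
  have Upsilon: "Upsilon q scale d v = scale (q * Q + 1 / (q * Q)) v" for v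
    using q by (simp add: Upsilon_def Q_def power_int_add power_int_diff power_int_minus field_simps)
  have span: "span (b ` {..d}) = UNIV"
    using b by (simp add: is_basis_def)
  have on_basis: "\<exists>n. v = w n \<and> 0 \<le> n \<and> n \<le> int d" if "v \<in> b ` {..d}" for v
  proof -
    from that obtain m where "m \<le> d" "v = b m" by auto
    then show ?thesis
      by (intro exI[of _ "int m"]) (simp add: w_def zero_extend_def)
  qed
  note identities = Upsilon_identities_on_basis[where w = w and u = u,
      OF lin[of 0 1] lin[of 1 2] lin[of 2 3] lin[of 3 0] q t nz u_shift x01 x12 x23 x30]
  show ?thesis
    unfolding Upsilon
    by (intro conjI allI; rule linear_relation_from_span[OF lin lin lin lin span];
        drule on_basis; elim exE conjE; hypsubst; rule identities; auto)
qed

end
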